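(* Let $X$ be a flow whose underlying space is a locally path-connected, compact metric space. Then $X$ is a $\check C_0^{\mathbf r}$-complete flow if and only if $C(X)=\overline{\Omega^{\mathbf r}(X)}$ and $C(X)$ is a Stone space.
   Context: Flows: a flow on a topological space $X$ is a continuous action $\mathbb R\times X\to X$, $(t,x)\mapsto t\cdot x$, of the additive group $\mathbb R$. $C(X)=\{x\in X: t\cdot x=x\ \forall t\in\mathbb R\}$ is the set of critical points. $\omega^{\mathbf r}(x)=\bigcap_{t\ge 0}\overline{[t,+\infty)\cdot x}$ and $\Omega^{\mathbf r}(X)=\bigcup_{x\in X}\omega^{\mathbf r}(x)$. A Stone space is a Hausdorff, compact, totally disconnected space (here $C(X)$ carries the subspace topology). Exterior spaces: an exterior space is a topological space $X$ with a nonempty family $\varepsilon(X)$ of open subsets (an externology) closed under finite intersections and under passing to larger open subsets. For a space $Y$, $\pi_0(Y)$ is the set of path-components with the quotient topology of $q_0\colon Y\to\pi_0(Y)$. $L(X)=\bigcap_{E\in\varepsilon(X)}E$ (subspace topology); $\check\pi_0(X)=\lim_{E\in\varepsilon(X)}\pi_0(E)$ (inverse limit topology), with projections $\eta_{0,E}\colon\check\pi_0(X)\to\pi_0(E)$; $e_0\colon L(X)\to\check\pi_0(X)$ sends $x$ to the family of path-components of $x$ in the sets $E$. Completion: $\check C_0(X)$ has underlying set the push-out $X\cup_{L(X)}\check\pi_0(X)$ of the inclusion $L(X)\to X$ and $e_0$, with canonical maps $p_0\colon X\to\check C_0(X)$, $\operatorname{in}_0\colon\check\pi_0(X)\to\check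 C_0(X)$. A subset $W$ is open iff (i) $p_0^{-1}(W)$ and $\operatorname{in}_0^{-1}(W)$ are open, and (ii) for each $a\in\operatorname{in}_0^{-1}(W)$ there are $E\in\varepsilon(X)$ and an open $G\subset\pi_0(E)$ with $a\in\eta_{0,E}^{-1}(G)\subset\operatorname{in}_0^{-1}(W)$ and $q_0^{-1}(G)\subset p_0^{-1}(W)$. Completion of a flow: for a flow $X$, $X^{\mathbf r}$ denotes $X$ with the externology $\varepsilon^{\mathbf r}(X)$ of all open $N\subset X$ such that for every $x\in X$ there is $t_0\in\mathbb R$ with $t\cdot x\in N$ for all $t>t_0$. $\check C_0^{\mathbf r}(X)$ is the space $\check C_0(X^{\mathbf r})$ with the flow $t\cdot p_0(x)=p_0(t\cdot x)$, $t\cdot\operatorname{in}_0(a)=\operatorname{in}_0(a)$. A flow $X$ is $\check C_0^{\mathbf r}$-complete if $p_0\colon X\to\check C_0^{\mathbf r}(X)$ is a homeomorphism. *)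

theory Defs
  imports "HOL-Analysis.Analysis"
begin

section \<open>Flows\<close>

definition flow :: "'a topology \<Rightarrow> (real \<Rightarrow> 'a \<Rightarrow> 'a) \<Rightarrow> bool" where
  "flow X \<phi> \<longleftrightarrow>
     continuous_map (prod_topology euclideanreal X) X (\<lambda>(t, x). \<phi> t x) \<and>
     (\<forall>x \<in> topspace X. \<phi> 0 x = x) \<and>
     (\<forall>s t. \<forall>x \<in> topspace X. \<phi> (s + t) x = \<phi> s (\<phi> t x))"

definition critical_points :: "'a topology \<Rightarrow> (real \<Rightarrow> 'a \<Rightarrow> 'a) \<Rightarrow> 'a set" where
  "critical_points X \<phi> = {x \<in> topspace X. \<forall>t. \<phi> t x = x}"

definition omega_limit :: "'a topology \<Rightarrow> (real \<Rightarrow> 'a \<Rightarrow> 'a) \<Rightarrow> 'a \<Rightarrow> 'a set" where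
  "omega_limit X \<phi> x = (\<Inter>t \<in> {0..}. X closure_of ((\<lambda>s. \<phi> s x) ` {t..}))"

definition Omega_limits :: "'a topology \<Rightarrow> (real \<Rightarrow> 'a \<Rightarrow> 'a) \<Rightarrow> 'a set" where
  "Omega_limits X \<phi> = (\<Union>x \<in> topspace X. omega_limit X \<phi> x)"

definition totally_disconnected_space :: "'a topology \<Rightarrow> bool" where
  "totally_disconnected_space X \<longleftrightarrow>
     (\<forall>x \<in> topspace X. connected_component_of_set X x = {x})"

definition Stone_space :: "'a topology \<Rightarrow> bool" where
  "Stone_space X \<longleftrightarrow>
     Hausdorff_space X \<and> compact_space X \<and> totally_disconnected_space X"


section \<open>The space of path components\<close>

text \<open>A point of \<open>pi0 Y\<close> is a path component of \<open>Y\<close>, regarded as a subset of \<open>topspace Y\<close>;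
  the projection \<open>q\<^sub>0\<close> is therefore \<open>path_component_of_set Y\<close>.\<close>

definition pi0 :: "'a topology \<Rightarrow> 'a set topology" where
  "pi0 Y = topology (\<lambda>G. G \<subseteq> path_components_of Y \<and>
             openin Y {x \<in> topspace Y. path_component_of_set Y x \<in> G})"

lemma istopology_pi0:
  "istopology (\<lambda>G. G \<subseteq> path_components_of Y \<and>
     openin Y {x \<in> topspace Y. path_component_of_set Y x \<in> G})" (is "istopology ?P")
  unfolding istopology_def
proof (intro conjI allI impI)
  fix S T assume S: "?P S" and T: "?P T"
  show "S \<inter> T \<subseteq> path_components_of Y" using S by blast
  have eq: "{x \<in> topspace Y. path_component_of_set Y x \<in> S \<inter> T} =
      {x \<in> topspace Y. path_component_of_set Y x \<in> S} \<inter>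
      {x \<in> topspace Y. path_component_of_set Y x \<in> T}" by blast
  show "openin Y {x \<in> topspace Y. path_component_of_set Y x \<in> S \<inter> T}"
    unfolding eq using S T by (intro openin_Int) auto
next
  fix \<K> assume K: "\<forall>S\<in>\<K>. ?P S"
  show "\<Union> \<K> \<subseteq> path_components_of Y" using K by blast
  have eq: "{x \<in> topspace Y. path_component_of_set Y x \<in> \<Union>\<K>} =
      (\<Union>S\<in>\<K>. {x \<in> topspace Y. path_component_of_set Y x \<in> S})" by blast
  show "openin Y {x \<in> topspace Y. path_component_of_set Y x \<in> \<Union>\<K>}"
    unfolding eq using K by (intro openin_Union) auto
qed

lemma openin_pi0:
  "openin (pi0 Y) G \<longleftrightarrow> G \<subseteq> path_components_of Y \<and>
     openin Y {x \<in> topspace Y. path_component_of_set Y x \<in> G}"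
  unfolding pi0_def by (simp add: topology_inverse'[OF istopology_pi0])

lemma path_components_of_memI:
  "x \<in> topspace Y \<Longrightarrow> path_component_of_set Y x \<in> path_components_of Y"
  by (simp add: path_components_of_def)

lemma topspace_pi0 [simp]: "topspace (pi0 Y) = path_components_of Y"
proof -
  have eq: "{x \<in> topspace Y. path_component_of_set Y x \<in> path_components_of Y} = topspace Y"
    by (auto simp: path_components_of_memI)
  have "openin (pi0 Y) (path_components_of Y)"
    by (simp add: openin_pi0 eq)
  then show ?thesis
    by (metis openin_pi0 openin_subset openin_topspace subset_antisym)
qed

lemma quotient_map_pi0: "quotient_map Y (pi0 Y) (path_component_of_set Y)"
  unfolding quotient_map_def
  by (auto simp: openin_pi0 path_components_of_def)

text \<open>The map \<open>\<pi>\<^sub>0(Y) \<rightarrow> \<pi>\<^sub>0(Z)\<close> induced by an inclusion of \<open>Y\<close> in \<open>Z\<close>: it sends a path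
  component \<open>C\<close> of \<open>Y\<close> to the path component of \<open>Z\<close> containing \<open>C\<close>. The sets in the
  union all coincide.\<close>

definition pi0_incl :: "'a topology \<Rightarrow> 'a set \<Rightarrow> 'a set" where
  "pi0_incl Z C = (\<Union>x \<in> C. path_component_of_set Z x)"

lemma pi0_incl_path_component:
  assumes "E \<subseteq> F" and "x \<in> topspace X" and "x \<in> E"
  shows "pi0_incl (subtopology X F) (path_component_of_set (subtopology X E) x) =
         path_component_of_set (subtopology X F) x"
proof -
  have "path_component_of (subtopology X F) x y" if "path_component_of (subtopology X E) x y" for y
    using path_component_of_mono that assms(1) by metis
  then have "path_component_of_set (subtopology X F) y = path_component_of_set (subtopology X F) x"
    if "y \<in> path_component_of_set (subtopology X E) x" for y
    using that by (metis mem_Collect_eq path_component_of_equiv)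
  moreover have "x \<in> path_component_of_set (subtopology X E) x"
    using assms by (simp add: path_component_of_refl)
  ultimately show ?thesis
    unfolding pi0_incl_def by blast
qed


section \<open>Exterior spaces and their completion\<close>

definition externology :: "'a topology \<Rightarrow> 'a set set \<Rightarrow> bool" where
  "externology X \<epsilon> \<longleftrightarrow>
     \<epsilon> \<noteq> {} \<and> (\<forall>E \<in> \<epsilon>. openin X E) \<and>
     (\<forall>E \<in> \<epsilon>. \<forall>F \<in> \<epsilon>. E \<inter> F \<in> \<epsilon>) \<and>
     (\<forall>E \<in> \<epsilon>. \<forall>U. openin X U \<and> E \<subseteq> U \<longrightarrow> U \<in> \<epsilon>)"

lemma externology_openin: "externology X \<epsilon> \<Longrightarrow> E \<in> \<epsilon> \<Longrightarrow> openin X E"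
  unfolding externology_def by blast

lemma externology_Int: "externology X \<epsilon> \<Longrightarrow> E \<in> \<epsilon> \<Longrightarrow> F \<in> \<epsilon> \<Longrightarrow> E \<inter> F \<in> \<epsilon>"
  unfolding externology_def by blast

definition ext_limit :: "'a set set \<Rightarrow> 'a set" where
  "ext_limit \<epsilon> = \<Inter>\<epsilon>"

text \<open>Points of the inverse limit are extensional families \<open>a\<close> with \<open>a E \<in> \<pi>\<^sub>0(E)\<close>, so the
  projection \<open>\<eta>\<close> to \<open>\<pi>\<^sub>0(E)\<close> is evaluation at \<open>E\<close>.\<close>

definition check_pi0 :: "'a topology \<Rightarrow> 'a set set \<Rightarrow> ('a set \<Rightarrow> 'a set) topology" where
  "check_pi0 X \<epsilon> =
     subtopology (product_topology (\<lambda>E. pi0 (subtopology X E)) \<epsilon>)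
       {a. \<forall>E \<in> \<epsilon>. \<forall>F \<in> \<epsilon>. E \<subseteq> F \<longrightarrow> pi0_incl (subtopology X F) (a E) = a F}"

lemma check_pi0_compat:
  assumes "a \<in> topspace (check_pi0 X \<epsilon>)" "D \<in> \<epsilon>" "E \<in> \<epsilon>" "D \<subseteq> E"
  shows "pi0_incl (subtopology X E) (a D) = a E"
  using assms unfolding check_pi0_def by simp

lemma check_pi0_mem:
  assumes "a \<in> topspace (check_pi0 X \<epsilon>)" "E \<in> \<epsilon>"
  shows "a E \<in> path_components_of (subtopology X E)"
  using assms unfolding check_pi0_def by (simp add: PiE_iff)

definition e0 :: "'a topology \<Rightarrow> 'a set set \<Rightarrow> 'a \<Rightarrow> ('a set \<Rightarrow> 'a set)" where
  "e0 X \<epsilon> x = (\<lambda>E \<in> \<epsilon>. path_component_of_set (subtopology X E) x)"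

text \<open>The push-out is the quotient of the disjoint union by the equivalence relation
  generated by \<open>Inl x \<sim> Inr (e\<^sub>0 x)\<close> for \<open>x\<close> in the limit set.\<close>

definition glue_rel ::
    "'a topology \<Rightarrow> 'a set set \<Rightarrow> ('a + ('a set \<Rightarrow> 'a set)) rel" where
  "glue_rel X \<epsilon> =
     {(u, v). equivclp (\<lambda>u v. \<exists>x \<in> ext_limit \<epsilon>. u = Inl x \<and> v = Inr (e0 X \<epsilon> x)) u v}"

definition completion_carrier ::
    "'a topology \<Rightarrow> 'a set set \<Rightarrow> ('a + ('a set \<Rightarrow> 'a set)) set set" where
  "completion_carrier X \<epsilon> =
     (topspace X <+> topspace (check_pi0 X \<epsilon>)) // glue_rel X \<epsilon>"

definition p0 :: "'a topology \<Rightarrow> 'a set set \<Rightarrow> 'a \<Rightarrow> ('a + ('a set \<Rightarrow> 'a set)) set" where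
  "p0 X \<epsilon> x = glue_rel X \<epsilon> `` {Inl x}"

definition in0 ::
    "'a topology \<Rightarrow> 'a set set \<Rightarrow> ('a set \<Rightarrow> 'a set) \<Rightarrow> ('a + ('a set \<Rightarrow> 'a set)) set" where
  "in0 X \<epsilon> a = glue_rel X \<epsilon> `` {Inr a}"

definition completion_open ::
    "'a topology \<Rightarrow> 'a set set \<Rightarrow> ('a + ('a set \<Rightarrow> 'a set)) set set \<Rightarrow> bool" where
  "completion_open X \<epsilon> W \<longleftrightarrow>
     W \<subseteq> completion_carrier X \<epsilon> \<and>
     openin X {x \<in> topspace X. p0 X \<epsilon> x \<in> W} \<and>
     openin (check_pi0 X \<epsilon>) {a \<in> topspace (check_pi0 X \<epsilon>). in0 X \<epsilon> a \<in> W} \<and>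
     (\<forall>a \<in> topspace (check_pi0 X \<epsilon>). in0 X \<epsilon> a \<in> W \<longrightarrow>
        (\<exists>E \<in> \<epsilon>. \<exists>G. openin (pi0 (subtopology X E)) G \<and> a E \<in> G \<and>
           {b \<in> topspace (check_pi0 X \<epsilon>). b E \<in> G}
             \<subseteq> {b \<in> topspace (check_pi0 X \<epsilon>). in0 X \<epsilon> b \<in> W} \<and>
           {x \<in> E. path_component_of_set (subtopology X E) x \<in> G}
             \<subseteq> {x \<in> topspace X. p0 X \<epsilon> x \<in> W}))"

definition check_C0 ::
    "'a topology \<Rightarrow> 'a set set \<Rightarrow> ('a + ('a set \<Rightarrow> 'a set)) set topology" where
  "check_C0 X \<epsilon> = topology (completion_open X \<epsilon>)"

lemma p0_in_carrier: "x \<in> topspace X \<Longrightarrow> p0 X \<epsilon> x \<in> completion_carrier X \<epsilon>"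
  unfolding p0_def completion_carrier_def by (auto intro!: quotientI)

lemma in0_in_carrier:
  "a \<in> topspace (check_pi0 X \<epsilon>) \<Longrightarrow> in0 X \<epsilon> a \<in> completion_carrier X \<epsilon>"
  unfolding in0_def completion_carrier_def by (auto intro!: quotientI)

lemma completion_open_Int:
  assumes ext: "externology X \<epsilon>"
    and S: "completion_open X \<epsilon> S" and T: "completion_open X \<epsilon> T"
  shows "completion_open X \<epsilon> (S \<inter> T)"
  unfolding completion_open_def
proof (intro conjI ballI impI)
  let ?P = "topspace (check_pi0 X \<epsilon>)"
  show "S \<inter> T \<subseteq> completion_carrier X \<epsilon>"
    using S by (auto simp: completion_open_def)
  have "{x \<in> topspace X. p0 X \<epsilon> x \<in> S \<inter> T} =
      {x \<in> topspace X. p0 X \<epsilon> x \<in> S} \<inter> {x \<in> topspace X. p0 X \<epsilon> x \<in> T}" by blast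
  then show "openin X {x \<in> topspace X. p0 X \<epsilon> x \<in> S \<inter> T}"
    using S T by (auto simp: completion_open_def)
  have "{a \<in> ?P. in0 X \<epsilon> a \<in> S \<inter> T} =
      {a \<in> ?P. in0 X \<epsilon> a \<in> S} \<inter> {a \<in> ?P. in0 X \<epsilon> a \<in> T}" by blast
  then show "openin (check_pi0 X \<epsilon>) {a \<in> ?P. in0 X \<epsilon> a \<in> S \<inter> T}"
    using S T by (auto simp: completion_open_def)
  fix a assume a: "a \<in> ?P" and aST: "in0 X \<epsilon> a \<in> S \<inter> T"
  obtain E G where E: "E \<in> \<epsilon>" and G: "openin (pi0 (subtopology X E)) G" "a E \<in> G"
    and G1: "{b \<in> ?P. b E \<in> G} \<subseteq> {b \<in> ?P. in0 X \<epsilon> b \<in> S}"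
    and G2: "{x \<in> E. path_component_of_set (subtopology X E) x \<in> G} \<subseteq>
             {x \<in> topspace X. p0 X \<epsilon> x \<in> S}"
    using S a aST unfolding completion_open_def by blast
  obtain F H where F: "F \<in> \<epsilon>" and H: "openin (pi0 (subtopology X F)) H" "a F \<in> H"
    and H1: "{b \<in> ?P. b F \<in> H} \<subseteq> {b \<in> ?P. in0 X \<epsilon> b \<in> T}"
    and H2: "{x \<in> F. path_component_of_set (subtopology X F) x \<in> H} \<subseteq>
             {x \<in> topspace X. p0 X \<epsilon> x \<in> T}"
    using T a aST unfolding completion_open_def by blast
  define D where "D = E \<inter> F"
  have D: "D \<in> \<epsilon>" "D \<subseteq> E" "D \<subseteq> F"
    using externology_Int[OF ext E F] by (auto simp: D_def)
  have op: "openin X E" "openin X F" "openin X D"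
    using externology_openin[OF ext] E F D(1) by auto
  have sub: "E \<subseteq> topspace X" "F \<subseteq> topspace X" "D \<subseteq> topspace X"
    using op by (auto dest: openin_subset)
  define K where "K = {C \<in> path_components_of (subtopology X D).
      pi0_incl (subtopology X E) C \<in> G \<and> pi0_incl (subtopology X F) C \<in> H}"
  have compat: "pi0_incl (subtopology X E) (b D) = b E" "pi0_incl (subtopology X F) (b D) = b F"
    "b D \<in> path_components_of (subtopology X D)" if "b \<in> ?P" for b
    using check_pi0_compat[OF that D(1)] check_pi0_mem[OF that D(1)] D E F by auto
  have memK: "path_component_of_set (subtopology X D) x \<in> K \<longleftrightarrow>
      path_component_of_set (subtopology X E) x \<in> G \<and>
      path_component_of_set (subtopology X F) x \<in> H" if "x \<in> D" for x
  proof -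
    have x: "x \<in> topspace X" using that sub(3) by blast
    then have "path_component_of_set (subtopology X D) x \<in> path_components_of (subtopology X D)"
      using that by (intro path_components_of_memI) simp
    then show ?thesis
      by (simp add: K_def pi0_incl_path_component[OF D(2) x that]
          pi0_incl_path_component[OF D(3) x that])
  qed
  have "openin (pi0 (subtopology X D)) K"
    unfolding openin_pi0
  proof
    show "K \<subseteq> path_components_of (subtopology X D)" by (auto simp: K_def)
    have eq: "{x \<in> topspace (subtopology X D). path_component_of_set (subtopology X D) x \<in> K} =
        D \<inter> ({x \<in> topspace (subtopology X E). path_component_of_set (subtopology X E) x \<in> G} \<inter>
             {x \<in> topspace (subtopology X F). path_component_of_set (subtopology X F) x \<in> H})"
      (is "?L = ?R")
    proof (rule set_eqI)
      fix x show "x \<in> ?L \<longleftrightarrow> x \<in> ?R"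
      proof (cases "x \<in> D")
        case True
        then show ?thesis using memK[OF True] D(2,3) sub(3) by (simp add: subset_iff)
      qed simp
    qed
    have
      "openin X {x \<in> topspace (subtopology X E). path_component_of_set (subtopology X E) x \<in> G}"
      "openin X {x \<in> topspace (subtopology X F). path_component_of_set (subtopology X F) x \<in> H}"
      using G(1) H(1) op by (simp_all add: openin_pi0 openin_open_subtopology)
    then show "openin (subtopology X D)
        {x \<in> topspace (subtopology X D). path_component_of_set (subtopology X D) x \<in> K}"
      unfolding eq openin_open_subtopology[OF op(3)]
      by (intro conjI openin_Int op(3) Int_lower1)
  qed
  moreover have "a D \<in> K"
    using compat[OF a] G(2) H(2) by (simp add: K_def)
  moreover have "{b \<in> ?P. b D \<in> K} \<subseteq> {b \<in> ?P. in0 X \<epsilon> b \<in> S \<inter> T}"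
  proof
    fix b assume "b \<in> {b \<in> ?P. b D \<in> K}"
    then have "b \<in> ?P" "b E \<in> G" "b F \<in> H"
      using compat by (auto simp: K_def)
    then show "b \<in> {b \<in> ?P. in0 X \<epsilon> b \<in> S \<inter> T}"
      using G1 H1 by blast
  qed
  moreover have "{x \<in> D. path_component_of_set (subtopology X D) x \<in> K} \<subseteq>
      {x \<in> topspace X. p0 X \<epsilon> x \<in> S \<inter> T}"
    using G2 H2 memK D by blast
  ultimately show "\<exists>E \<in> \<epsilon>. \<exists>G. openin (pi0 (subtopology X E)) G \<and> a E \<in> G \<and>
           {b \<in> ?P. b E \<in> G} \<subseteq> {b \<in> ?P. in0 X \<epsilon> b \<in> S \<inter> T} \<and>
           {x \<in> E. path_component_of_set (subtopology X E) x \<in> G}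
             \<subseteq> {x \<in> topspace X. p0 X \<epsilon> x \<in> S \<inter> T}"
    using D(1) by blast
qed

lemma completion_open_Union:
  assumes K: "\<And>S. S \<in> \<K> \<Longrightarrow> completion_open X \<epsilon> S"
  shows "completion_open X \<epsilon> (\<Union>\<K>)"
  unfolding completion_open_def
proof (intro conjI ballI impI)
  let ?P = "topspace (check_pi0 X \<epsilon>)"
  show "\<Union>\<K> \<subseteq> completion_carrier X \<epsilon>"
    using K unfolding completion_open_def by (intro Sup_least) blast
  have eq: "{x \<in> topspace X. p0 X \<epsilon> x \<in> \<Union>\<K>} = (\<Union>S\<in>\<K>. {x \<in> topspace X. p0 X \<epsilon> x \<in> S})"
    by blast
  show "openin X {x \<in> topspace X. p0 X \<epsilon> x \<in> \<Union>\<K>}"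
    unfolding eq using K by (intro openin_Union) (auto simp: completion_open_def)
  have eq: "{a \<in> ?P. in0 X \<epsilon> a \<in> \<Union>\<K>} = (\<Union>S\<in>\<K>. {a \<in> ?P. in0 X \<epsilon> a \<in> S})"
    by blast
  show "openin (check_pi0 X \<epsilon>) {a \<in> ?P. in0 X \<epsilon> a \<in> \<Union>\<K>}"
    unfolding eq using K by (intro openin_Union) (auto simp: completion_open_def)
  fix a assume a: "a \<in> ?P" and "in0 X \<epsilon> a \<in> \<Union>\<K>"
  then obtain S where S: "S \<in> \<K>" "in0 X \<epsilon> a \<in> S" by blast
  obtain E G where "E \<in> \<epsilon>" "openin (pi0 (subtopology X E)) G" "a E \<in> G"
    and "{b \<in> ?P. b E \<in> G} \<subseteq> {b \<in> ?P. in0 X \<epsilon> b \<in> S}"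
    and "{x \<in> E. path_component_of_set (subtopology X E) x \<in> G} \<subseteq>
             {x \<in> topspace X. p0 X \<epsilon> x \<in> S}"
    using K[OF S(1)] a S(2) unfolding completion_open_def by blast
  moreover have "{b \<in> ?P. in0 X \<epsilon> b \<in> S} \<subseteq> {b \<in> ?P. in0 X \<epsilon> b \<in> \<Union>\<K>}"
    "{x \<in> topspace X. p0 X \<epsilon> x \<in> S} \<subseteq> {x \<in> topspace X. p0 X \<epsilon> x \<in> \<Union>\<K>}"
    using S(1) by blast+
  ultimately show "\<exists>E \<in> \<epsilon>. \<exists>G. openin (pi0 (subtopology X E)) G \<and> a E \<in> G \<and>
           {b \<in> ?P. b E \<in> G} \<subseteq> {b \<in> ?P. in0 X \<epsilon> b \<in> \<Union>\<K>} \<and>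
           {x \<in> E. path_component_of_set (subtopology X E) x \<in> G}
             \<subseteq> {x \<in> topspace X. p0 X \<epsilon> x \<in> \<Union>\<K>}"
    by (meson subset_trans)
qed

lemma openin_check_C0:
  assumes "externology X \<epsilon>"
  shows "openin (check_C0 X \<epsilon>) W \<longleftrightarrow> completion_open X \<epsilon> W"
proof -
  have "istopology (completion_open X \<epsilon>)"
    unfolding istopology_def
    using completion_open_Int[OF assms] completion_open_Union by blast
  then show ?thesis
    by (simp add: check_C0_def topology_inverse')
qed

lemma topspace_check_C0:
  assumes "externology X \<epsilon>"
  shows "topspace (check_C0 X \<epsilon>) = completion_carrier X \<epsilon>"
proof -
  let ?P = "topspace (check_pi0 X \<epsilon>)"
  obtain E where E: "E \<in> \<epsilon>" "E \<subseteq> topspace X"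
    using assms unfolding externology_def by (meson ex_in_conv openin_subset)
  have eq: "{x \<in> topspace X. p0 X \<epsilon> x \<in> completion_carrier X \<epsilon>} = topspace X"
    "{a \<in> ?P. in0 X \<epsilon> a \<in> completion_carrier X \<epsilon>} = ?P"
    by (auto simp: p0_in_carrier in0_in_carrier)
  have "a E \<in> path_components_of (subtopology X E)" if "a \<in> ?P" for a
    using check_pi0_mem[OF that E(1)] .
  moreover have "openin (pi0 (subtopology X E)) (path_components_of (subtopology X E))"
    by (metis openin_topspace topspace_pi0)
  ultimately have "completion_open X \<epsilon> (completion_carrier X \<epsilon>)"
    unfolding completion_open_def eq using E by blast
  then have "openin (check_C0 X \<epsilon>) (completion_carrier X \<epsilon>)"
    by (simp add: openin_check_C0[OF assms])
  moreover have "topspace (check_C0 X \<epsilon>) \<subseteq> completion_carrier X \<epsilon>"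
    by (metis assms completion_open_def openin_check_C0 openin_topspace)
  ultimately show ?thesis
    by (meson openin_subset subset_antisym)
qed


section \<open>Complete flows\<close>

definition eps_r :: "'a topology \<Rightarrow> (real \<Rightarrow> 'a \<Rightarrow> 'a) \<Rightarrow> 'a set set" where
  "eps_r X \<phi> = {N. openin X N \<and> (\<forall>x \<in> topspace X. \<exists>t0. \<forall>t>t0. \<phi> t x \<in> N)}"

lemma externology_eps_r:
  assumes "flow X \<phi>"
  shows "externology X (eps_r X \<phi>)"
  unfolding externology_def
proof (intro conjI ballI allI impI)
  have "\<phi> t x \<in> topspace X" if "x \<in> topspace X" for t x
  proof -
    have "(\<lambda>(t, x). \<phi> t x) \<in> topspace (prod_topology euclideanreal X) \<rightarrow> topspace X"
      using assms unfolding flow_def by (intro continuous_map_funspace) (rule conjunct1)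
    moreover have "(t, x) \<in> topspace (prod_topology euclideanreal X)"
      using that by simp
    ultimately show ?thesis using Pi_mem by fastforce
  qed
  then have "topspace X \<in> eps_r X \<phi>"
    by (auto simp: eps_r_def)
  then show "eps_r X \<phi> \<noteq> {}" by blast
next
  fix E F assume EF: "E \<in> eps_r X \<phi>" "F \<in> eps_r X \<phi>"
  have "\<exists>t0. \<forall>t>t0. \<phi> t x \<in> E \<inter> F" if "x \<in> topspace X" for x
  proof -
    have "\<exists>r. \<forall>t>r. \<phi> t x \<in> E" "\<exists>s. \<forall>t>s. \<phi> t x \<in> F"
      using EF that by (simp_all add: eps_r_def)
    then obtain r s where "\<forall>t>r. \<phi> t x \<in> E" "\<forall>t>s. \<phi> t x \<in> F" by (elim exE)
    then show ?thesis by (intro exI[of _ "max r s"]) simp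
  qed
  then show "E \<inter> F \<in> eps_r X \<phi>"
    using EF by (simp add: eps_r_def openin_Int)
next
  fix E U assume "E \<in> eps_r X \<phi>" and "openin X U \<and> E \<subseteq> U"
  then show "U \<in> eps_r X \<phi>"
    unfolding eps_r_def mem_Collect_eq by (meson subsetD)
qed (simp add: eps_r_def)

text \<open>Completeness only refers to the topology of the completion, not to the flow on it.\<close>

definition check_C0_r_complete :: "'a topology \<Rightarrow> (real \<Rightarrow> 'a \<Rightarrow> 'a) \<Rightarrow> bool" where
  "check_C0_r_complete X \<phi> \<longleftrightarrow>
     homeomorphic_map X (check_C0 X (eps_r X \<phi>)) (p0 X (eps_r X \<phi>))"

end

theory Submission
  imports Defs
begin

text \<open>
  Write \<open>\<epsilon>\<close> for \<open>eps_r X \<phi>\<close>, \<open>L\<close> for its limit space, \<open>C\<close> for the set of critical points and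
  \<open>\<Omega>\<close> for the union of the omega-limits. Because \<open>X\<close> is locally path-connected, each \<open>\<pi>\<^sub>0(E)\<close> with
  \<open>E\<close> open is discrete, and the completion map \<open>p\<^sub>0\<close> is a homeomorphism exactly when
  \<open>e\<^sub>0 : L \<rightarrow> lim \<pi>\<^sub>0(E)\<close> is bijective and every neighbourhood of a point \<open>x\<close> of \<open>L\<close> contains the
  path component of \<open>x\<close> in some \<open>E \<in> \<epsilon>\<close> (\<open>homeomorphic_p0_imp\<close>, \<open>homeomorphic_p0I\<close>). These two
  conditions are then compared with the dynamics.

  Suppose that they hold. The set \<open>L\<close> is invariant, and \<open>e\<^sub>0\<close> is constant on an orbit inside \<open>L\<close>
  since the orbit is a path in every \<open>E\<close>; so injectivity forces \<open>L = C\<close>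
  (\<open>ext_limit_eq_critical_points\<close>). The forward orbit of any point ends up in a single path
  component of each \<open>E\<close> and thus defines a point of the inverse limit
  (\<open>orbit_end_component\<close>), which is \<open>e\<^sub>0(c)\<close> for some \<open>c \<in> L\<close>; as the components of \<open>c\<close> are
  arbitrarily small, the orbit converges to \<open>c\<close>. Hence \<open>\<Omega> = L = C\<close>, which is closed. The
  small components, being relatively clopen, also separate the points of \<open>L\<close>, so \<open>C\<close> is totally
  disconnected.

  Conversely, let \<open>C\<close> be the closure of \<open>\<Omega>\<close> and a Stone space. By compactness of \<open>X\<close> every open
  set containing \<open>\<Omega>\<close> belongs to \<open>\<epsilon>\<close> (\<open>eps_r_if_Omega_limits_subset\<close>); it follows that \<open>L = C\<close>
  and that \<open>\<epsilon>\<close> consists of all open neighbourhoods of \<open>C\<close>. Clopen subsets of \<open>C\<close> extend to disjoint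
  open subsets of \<open>X\<close>, which yields the small components (\<open>small_path_components_Stone\<close>) and
  thereby injectivity of \<open>e\<^sub>0\<close>. For surjectivity, a point of the inverse limit is a directed family
  of path components, each of which meets the compact set \<open>C\<close> in a nonempty closed set
  (\<open>e0_surj_compact\<close>).
\<close>

section \<open>The push-out as a set\<close>

text \<open>A normal form for the gluing relation: points of the limit space are replaced by their
  images in the inverse limit and all other points are left alone. Since \<open>L\<close> is embedded in
  \<open>X\<close>, no further identifications arise, and equality in the push-out becomes equality of normal
  forms.\<close>

definition glue_rep ::
    "'a topology \<Rightarrow> 'a set set \<Rightarrow> 'a + ('a set \<Rightarrow> 'a set) \<Rightarrow> 'a + ('a set \<Rightarrow> 'a set)" where
  "glue_rep X \<epsilon> u =
     (case u of Inl x \<Rightarrow> if x \<in> ext_limit \<epsilon> then Inr (e0 X \<epsilon> x) else Inl x | Inr a \<Rightarrow> Inr a)"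

lemma glue_rep_simps:
  "x \<in> ext_limit \<epsilon> \<Longrightarrow> glue_rep X \<epsilon> (Inl x) = Inr (e0 X \<epsilon> x)"
  "x \<notin> ext_limit \<epsilon> \<Longrightarrow> glue_rep X \<epsilon> (Inl x) = Inl x"
  "glue_rep X \<epsilon> (Inr a) = Inr a"
  by (simp_all add: glue_rep_def)

lemma glue_rel_iff: "(u, v) \<in> glue_rel X \<epsilon> \<longleftrightarrow> glue_rep X \<epsilon> u = glue_rep X \<epsilon> v"
proof -
  let ?r = "\<lambda>u v. \<exists>x \<in> ext_limit \<epsilon>. u = Inl x \<and> v = Inr (e0 X \<epsilon> x)"
  have "glue_rep X \<epsilon> u = glue_rep X \<epsilon> v" if "equivclp ?r u v" for u v
    using that by (induction rule: equivclp_induct) (auto simp: glue_rep_simps)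
  moreover have rep: "equivclp ?r u (glue_rep X \<epsilon> u)" for u
    by (cases u) (auto simp: glue_rep_def)
  have "equivclp ?r u v" if "glue_rep X \<epsilon> u = glue_rep X \<epsilon> v"
    using equivclp_trans[OF rep[of u] equivclp_sym[OF rep[of v, folded that]]] .
  ultimately show ?thesis
    by (auto simp: glue_rel_def)
qed

lemma glue_class_eq_iff:
  "glue_rel X \<epsilon> `` {u} = glue_rel X \<epsilon> `` {v} \<longleftrightarrow> glue_rep X \<epsilon> u = glue_rep X \<epsilon> v"
  by (auto simp: glue_rel_iff set_eq_iff)

lemma p0_eq_p0_iff:
  "p0 X \<epsilon> x = p0 X \<epsilon> y \<longleftrightarrow>
     x = y \<or> x \<in> ext_limit \<epsilon> \<and> y \<in> ext_limit \<epsilon> \<and> e0 X \<epsilon> x = e0 X \<epsilon> y"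
  by (auto simp: p0_def glue_class_eq_iff glue_rep_def)

lemma in0_eq_p0_iff: "in0 X \<epsilon> a = p0 X \<epsilon> x \<longleftrightarrow> x \<in> ext_limit \<epsilon> \<and> e0 X \<epsilon> x = a"
  by (auto simp: p0_def in0_def glue_class_eq_iff glue_rep_def)

lemma completion_carrier_eq:
  "completion_carrier X \<epsilon> = p0 X \<epsilon> ` topspace X \<union> in0 X \<epsilon> ` topspace (check_pi0 X \<epsilon>)"
  by (auto simp: completion_carrier_def quotient_def p0_def in0_def)

section \<open>When the completion map is a homeomorphism\<close>

lemma ext_limit_subset: "E \<in> \<epsilon> \<Longrightarrow> ext_limit \<epsilon> \<subseteq> E"
  by (auto simp: ext_limit_def)

lemma ext_limit_subset_topspace:
  assumes "externology X \<epsilon>"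
  shows "ext_limit \<epsilon> \<subseteq> topspace X"
  using assms ext_limit_subset openin_subset unfolding externology_def by (metis ex_in_conv subset_trans)

lemma topspace_check_pi0:
  "topspace (check_pi0 X \<epsilon>) =
     {a \<in> (\<Pi>\<^sub>E E\<in>\<epsilon>. path_components_of (subtopology X E)).
        \<forall>E \<in> \<epsilon>. \<forall>F \<in> \<epsilon>. E \<subseteq> F \<longrightarrow> pi0_incl (subtopology X F) (a E) = a F}"
  by (auto simp: check_pi0_def)

lemma e0_in_check_pi0:
  assumes "externology X \<epsilon>" and "x \<in> ext_limit \<epsilon>"
  shows "e0 X \<epsilon> x \<in> topspace (check_pi0 X \<epsilon>)"
proof -
  have x: "x \<in> topspace X" "\<And>E. E \<in> \<epsilon> \<Longrightarrow> x \<in> E"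
    using assms(2) ext_limit_subset_topspace[OF assms(1)] by (auto simp: ext_limit_def)
  then show ?thesis
    by (auto simp: topspace_check_pi0 e0_def pi0_incl_path_component intro!: path_components_of_memI)
qed

lemma path_component_of_set_eqI:
  "path_component_of X x y \<Longrightarrow> path_component_of_set X x = path_component_of_set X y"
  by (metis path_component_of_equiv)

lemma openin_pi0_singleton:
  assumes "locally_path_connected_space Y" and "x \<in> topspace Y"
  shows "openin (pi0 Y) {path_component_of_set Y x}"
proof -
  have "{y \<in> topspace Y. path_component_of_set Y y \<in> {path_component_of_set Y x}} =
      path_component_of_set Y x"
    using assms(2) path_component_of_equiv[of Y x] path_component_of_refl[of Y]
      path_component_of_set_eqI[of Y x] path_component_in_topspace[of Y x] by blast
  then show ?thesis
    using assms by (simp add: openin_pi0 path_components_of_memI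
        openin_path_component_of_locally_path_connected_space)
qed

text \<open>The part of completeness that concerns the topology: it makes every open set of \<open>X\<close> satisfy
  condition (ii), in the definition of the completion, at its points in the limit space.\<close>

definition small_path_components :: "'a topology \<Rightarrow> 'a set set \<Rightarrow> bool" where
  "small_path_components X \<epsilon> \<longleftrightarrow>
     (\<forall>x \<in> ext_limit \<epsilon>. \<forall>U. openin X U \<and> x \<in> U \<longrightarrow>
        (\<exists>E \<in> \<epsilon>. path_component_of_set (subtopology X E) x \<subseteq> U))"

lemma continuous_map_p0:
  assumes "externology X \<epsilon>"
  shows "continuous_map X (check_C0 X \<epsilon>) (p0 X \<epsilon>)"
  using assms
  by (auto simp: continuous_map_def topspace_check_C0 openin_check_C0 p0_in_carrier completion_open_def)

text \<open>Bijectivity of \<open>e\<^sub>0\<close> is what bijectivity of \<open>p\<^sub>0\<close> means for the push-out. The small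
  components come from condition (ii) for the open set \<open>p\<^sub>0(U)\<close> at the point \<open>e\<^sub>0(x)\<close>: the set
  \<open>q\<^sub>0\<^sup>-\<^sup>1(G)\<close> found there contains the whole path component of \<open>x\<close>.\<close>

lemma homeomorphic_p0_imp:
  assumes ext: "externology X \<epsilon>" and hom: "homeomorphic_map X (check_C0 X \<epsilon>) (p0 X \<epsilon>)"
  shows "bij_betw (e0 X \<epsilon>) (ext_limit \<epsilon>) (topspace (check_pi0 X \<epsilon>))"
    and "small_path_components X \<epsilon>"
proof -
  have L: "ext_limit \<epsilon> \<subseteq> topspace X"
    using ext_limit_subset_topspace[OF ext] .
  have inj: "inj_on (p0 X \<epsilon>) (topspace X)" and op: "open_map X (check_C0 X \<epsilon>) (p0 X \<epsilon>)"
    and surj: "p0 X \<epsilon> ` topspace X = completion_carrier X \<epsilon>"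
    using hom topspace_check_C0[OF ext] by (auto simp: homeomorphic_eq_everything_map)
  have "inj_on (e0 X \<epsilon>) (ext_limit \<epsilon>)"
    by (rule inj_onI) (metis L inj inj_onD p0_eq_p0_iff subsetD)
  moreover have "\<exists>x \<in> ext_limit \<epsilon>. e0 X \<epsilon> x = a" if "a \<in> topspace (check_pi0 X \<epsilon>)" for a
    using in0_in_carrier[OF that] surj in0_eq_p0_iff by (metis imageE)
  ultimately show "bij_betw (e0 X \<epsilon>) (ext_limit \<epsilon>) (topspace (check_pi0 X \<epsilon>))"
    using e0_in_check_pi0[OF ext] by (auto simp: bij_betw_def)
  show "small_path_components X \<epsilon>"
    unfolding small_path_components_def
  proof (intro ballI allI impI)
    fix x U assume x: "x \<in> ext_limit \<epsilon>" and U: "openin X U \<and> x \<in> U"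
    then have "completion_open X \<epsilon> (p0 X \<epsilon> ` U)"
      using op openin_check_C0[OF ext] by (auto simp: open_map_def)
    moreover have "in0 X \<epsilon> (e0 X \<epsilon> x) \<in> p0 X \<epsilon> ` U"
      using U x in0_eq_p0_iff by (metis imageI)
    ultimately obtain E G where E: "E \<in> \<epsilon>" "e0 X \<epsilon> x E \<in> G"
      and G: "{y \<in> E. path_component_of_set (subtopology X E) y \<in> G}
             \<subseteq> {y \<in> topspace X. p0 X \<epsilon> y \<in> p0 X \<epsilon> ` U}"
      using e0_in_check_pi0[OF ext x] unfolding completion_open_def by blast
    have "y \<in> U" if y: "path_component_of (subtopology X E) x y" for y
    proof -
      have "y \<in> E" using path_component_in_topspace[OF y] by simp
      moreover have "path_component_of_set (subtopology X E) y \<in> G"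
        using E path_component_of_set_eqI[OF y] by (simp add: e0_def)
      ultimately have "y \<in> topspace X" "p0 X \<epsilon> y \<in> p0 X \<epsilon> ` U"
        using G by blast+
      then show ?thesis
        using inj openin_subset[of X U] U by (auto dest: inj_onD)
    qed
    then show "\<exists>E \<in> \<epsilon>. path_component_of_set (subtopology X E) x \<subseteq> U"
      using E(1) by blast
  qed
qed

text \<open>Only openness of \<open>p\<^sub>0\<close> needs an argument. Given \<open>U\<close> open and \<open>x \<in> L \<inter> U\<close>, take \<open>E\<close> such that
  the path component of \<open>x\<close> in \<open>E\<close> lies in \<open>U\<close>. Local path-connectedness makes this component an
  isolated point of \<open>\<pi>\<^sub>0(E)\<close>, so the singleton can serve as the set \<open>G\<close> in condition (ii).\<close>

lemma homeomorphic_p0I: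
  assumes ext: "externology X \<epsilon>" and lpc: "locally_path_connected_space X"
    and bij: "bij_betw (e0 X \<epsilon>) (ext_limit \<epsilon>) (topspace (check_pi0 X \<epsilon>))"
    and small: "small_path_components X \<epsilon>"
  shows "homeomorphic_map X (check_C0 X \<epsilon>) (p0 X \<epsilon>)"
proof (rule bijective_open_imp_homeomorphic_map)
  let ?P = "topspace (check_pi0 X \<epsilon>)"
  have L: "ext_limit \<epsilon> \<subseteq> topspace X"
    using ext_limit_subset_topspace[OF ext] .
  have e0inj: "x = y" if "x \<in> ext_limit \<epsilon>" "y \<in> ext_limit \<epsilon>" "e0 X \<epsilon> x = e0 X \<epsilon> y" for x y
    using bij that by (auto simp: bij_betw_def dest: inj_onD)
  have e0surj: "\<exists>x \<in> ext_limit \<epsilon>. e0 X \<epsilon> x = a" if "a \<in> ?P" for a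
    using bij that by (metis bij_betw_imp_surj_on imageE)
  have p0inj: "p0 X \<epsilon> x = p0 X \<epsilon> y \<longleftrightarrow> x = y" for x y
    using e0inj by (auto simp: p0_eq_p0_iff)
  show "continuous_map X (check_C0 X \<epsilon>) (p0 X \<epsilon>)"
    by (rule continuous_map_p0[OF ext])
  show "inj_on (p0 X \<epsilon>) (topspace X)"
    by (simp add: inj_on_def p0inj)
  show "p0 X \<epsilon> ` topspace X = topspace (check_C0 X \<epsilon>)"
  proof -
    have "in0 X \<epsilon> a \<in> p0 X \<epsilon> ` topspace X" if "a \<in> ?P" for a
      using e0surj[OF that] L in0_eq_p0_iff by (metis imageI subsetD)
    then show ?thesis
      by (auto simp: topspace_check_C0[OF ext] completion_carrier_eq)
  qed
  have in0_mem: "in0 X \<epsilon> (e0 X \<epsilon> x) \<in> p0 X \<epsilon> ` U \<longleftrightarrow> x \<in> U" if "x \<in> ext_limit \<epsilon>" for x U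
    using that in0_eq_p0_iff e0inj by (metis image_iff)
  show "open_map X (check_C0 X \<epsilon>) (p0 X \<epsilon>)"
    unfolding open_map_def openin_check_C0[OF ext]
  proof (intro allI impI)
    fix U assume U: "openin X U"
    have Usub: "U \<subseteq> topspace X"
      by (rule openin_subset[OF U])
    define V where "V = {a \<in> ?P. in0 X \<epsilon> a \<in> p0 X \<epsilon> ` U}"
    have p0V: "{x \<in> topspace X. p0 X \<epsilon> x \<in> p0 X \<epsilon> ` U} = U"
      using Usub by (auto simp: p0inj)
    (* Condition (ii); through the projections, it also makes V open in the inverse limit. *)
    have key: "\<exists>E \<in> \<epsilon>. \<exists>G. openin (pi0 (subtopology X E)) G \<and> a E \<in> G \<and>
        {b \<in> ?P. b E \<in> G} \<subseteq> V \<and> {x \<in> E. path_component_of_set (subtopology X E) x \<in> G} \<subseteq> U"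
      if aV: "a \<in> V" for a
    proof -
      obtain x where x: "x \<in> ext_limit \<epsilon>" "a = e0 X \<epsilon> x"
        using e0surj[of a] aV unfolding V_def by blast
      then have "x \<in> U"
        using aV in0_mem by (simp add: V_def)
      then obtain E where E: "E \<in> \<epsilon>" and EU: "path_component_of_set (subtopology X E) x \<subseteq> U"
        using small x(1) U unfolding small_path_components_def by blast
      have opE: "openin X E" and LE: "ext_limit \<epsilon> \<subseteq> E"
        using externology_openin[OF ext E] ext_limit_subset[OF E] .
      have inE: "y \<in> U" if "y \<in> E"
        "path_component_of_set (subtopology X E) y = path_component_of_set (subtopology X E) x" for y
        using EU that path_component_of_refl[of "subtopology X E" y] openin_subset[OF opE] by auto
      let ?G = "{path_component_of_set (subtopology X E) x}"
      have "openin (pi0 (subtopology X E)) ?G"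
        using x(1) L LE by (intro openin_pi0_singleton locally_path_connected_space_open_subset lpc opE) auto
      moreover have "a E \<in> ?G"
        using E x by (simp add: e0_def)
      moreover have "{b \<in> ?P. b E \<in> ?G} \<subseteq> V"
      proof safe
        fix b assume b: "b \<in> ?P" "b E = path_component_of_set (subtopology X E) x"
        obtain y where y: "y \<in> ext_limit \<epsilon>" "b = e0 X \<epsilon> y"
          using e0surj[OF b(1)] by blast
        then have "y \<in> U"
          using b(2) E LE inE by (auto simp: e0_def)
        then show "b \<in> V"
          using b(1) y in0_mem by (simp add: V_def)
      qed
      moreover have "{y \<in> E. path_component_of_set (subtopology X E) y \<in> ?G} \<subseteq> U"
        using inE by blast
      ultimately show ?thesis
        using E by blast
    qed
    have "openin (check_pi0 X \<epsilon>) V"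
    proof (subst openin_subopen, intro ballI)
      fix a assume a: "a \<in> V"
      obtain E G where E: "E \<in> \<epsilon>" "openin (pi0 (subtopology X E)) G" "a E \<in> G"
        "{b \<in> ?P. b E \<in> G} \<subseteq> V"
        using key[OF a] by blast
      have "continuous_map (check_pi0 X \<epsilon>) (pi0 (subtopology X E)) (\<lambda>b. b E)"
        unfolding check_pi0_def
        by (intro continuous_map_from_subtopology continuous_map_product_projection E)
      then have "openin (check_pi0 X \<epsilon>) {b \<in> ?P. b E \<in> G}"
        using E(2) openin_continuous_map_preimage by blast
      then show "\<exists>T. openin (check_pi0 X \<epsilon>) T \<and> a \<in> T \<and> T \<subseteq> V"
        using E a by (intro exI[of _ "{b \<in> ?P. b E \<in> G}"]) (auto simp: V_def)
    qed
    moreover have "p0 X \<epsilon> ` U \<subseteq> completion_carrier X \<epsilon>"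
      using Usub by (auto intro!: p0_in_carrier)
    ultimately show "completion_open X \<epsilon> (p0 X \<epsilon> ` U)"
      unfolding completion_open_def p0V V_def[symmetric]
    proof (intro conjI ballI impI U)
      fix a assume "a \<in> ?P" "in0 X \<epsilon> a \<in> p0 X \<epsilon> ` U"
      then have "a \<in> V" by (simp add: V_def)
      then show "\<exists>E \<in> \<epsilon>. \<exists>G. openin (pi0 (subtopology X E)) G \<and> a E \<in> G \<and>
        {b \<in> ?P. b E \<in> G} \<subseteq> V \<and> {x \<in> E. path_component_of_set (subtopology X E) x \<in> G} \<subseteq> U"
        by (rule key)
    qed
  qed
qed

section \<open>Flows: orbits, critical points and the limit space\<close>

lemma flow_continuous_map:
  "flow X \<phi> \<Longrightarrow> continuous_map (prod_topology euclideanreal X) X (\<lambda>(t, x). \<phi> t x)"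
  by (simp add: flow_def)

lemma flow_add: "flow X \<phi> \<Longrightarrow> x \<in> topspace X \<Longrightarrow> \<phi> (s + t) x = \<phi> s (\<phi> t x)"
  by (simp add: flow_def)

lemma continuous_map_flow_time:
  assumes "flow X \<phi>" and "x \<in> topspace X"
  shows "continuous_map euclideanreal X (\<lambda>t. \<phi> t x)"
proof -
  have "continuous_map euclideanreal (prod_topology euclideanreal X) (\<lambda>t. (t, x))"
    using assms(2) by (simp add: continuous_map_pairwise o_def)
  from continuous_map_compose[OF this flow_continuous_map[OF assms(1)]]
  show ?thesis by (simp add: o_def)
qed

lemma continuous_map_flow_space:
  assumes "flow X \<phi>"
  shows "continuous_map X X (\<phi> t)"
proof -
  have "continuous_map X (prod_topology euclideanreal X) (\<lambda>x. (t, x))"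
    by (simp add: continuous_map_pairwise o_def)
  from continuous_map_compose[OF this flow_continuous_map[OF assms(1)]]
  show ?thesis by (simp add: o_def)
qed

lemma flow_in_topspace: "flow X \<phi> \<Longrightarrow> x \<in> topspace X \<Longrightarrow> \<phi> t x \<in> topspace X"
  using continuous_map_image_subset_topspace[OF continuous_map_flow_space] by blast

lemma path_component_of_flow:
  assumes "flow X \<phi>" and "x \<in> topspace X"
    and "is_interval T" and "s \<in> T" "t \<in> T" and "\<And>r. r \<in> T \<Longrightarrow> \<phi> r x \<in> E"
  shows "path_component_of (subtopology X E) (\<phi> s x) (\<phi> t x)"
proof -
  have "path_connectedin euclideanreal T"
    using assms(3) by (simp add: is_interval_path_connected)
  then have "path_connectedin X ((\<lambda>r. \<phi> r x) ` T)"
    using path_connectedin_continuous_map_image continuous_map_flow_time[OF assms(1,2)] by blast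
  then have "path_connectedin (subtopology X E) ((\<lambda>r. \<phi> r x) ` T)"
    using assms(6) by (auto simp: path_connectedin_subtopology)
  then show ?thesis
    using assms(4,5) by (auto simp: path_component_of)
qed

text \<open>The time-\<open>t\<close> preimage of an exterior set is again exterior, because \<open>t + s\<close> tends to
  infinity with \<open>s\<close>.\<close>

lemma ext_limit_eps_r_invariant:
  assumes fl: "flow X \<phi>" and x: "x \<in> ext_limit (eps_r X \<phi>)"
  shows "\<phi> t x \<in> ext_limit (eps_r X \<phi>)"
  unfolding ext_limit_def
proof
  fix N assume N: "N \<in> eps_r X \<phi>"
  have "{y \<in> topspace X. \<phi> t y \<in> N} \<in> eps_r X \<phi>"
    unfolding eps_r_def mem_Collect_eq
  proof (intro conjI ballI)
    show "openin X {y \<in> topspace X. \<phi> t y \<in> N}"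
      using N openin_continuous_map_preimage[OF continuous_map_flow_space[OF fl]]
      by (auto simp: eps_r_def)
    fix y assume y: "y \<in> topspace X"
    obtain t0 where t0: "\<And>s. s > t0 \<Longrightarrow> \<phi> s y \<in> N"
      using N y by (auto simp: eps_r_def)
    have "\<phi> t (\<phi> s y) \<in> N" if "s > t0 - t" for s
      using t0[of "t + s"] that flow_add[OF fl y] by simp
    then show "\<exists>t0. \<forall>s>t0. \<phi> s y \<in> topspace X \<and> \<phi> t (\<phi> s y) \<in> N"
      using flow_in_topspace[OF fl y] by blast
  qed
  then show "\<phi> t x \<in> N"
    using x by (auto simp: ext_limit_def)
qed

lemma critical_points_subset_ext_limit: "critical_points X \<phi> \<subseteq> ext_limit (eps_r X \<phi>)"
proof (clarsimp simp: critical_points_def ext_limit_def eps_r_def)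
  fix x N assume "x \<in> topspace X" "\<forall>t. \<phi> t x = x" "\<forall>x\<in>topspace X. \<exists>t0. \<forall>t>t0. \<phi> t x \<in> N"
  then show "x \<in> N" using gt_ex by metis
qed

lemma Omega_limits_subset_topspace: "Omega_limits X \<phi> \<subseteq> topspace X"
proof
  fix y assume "y \<in> Omega_limits X \<phi>"
  then obtain x where "y \<in> omega_limit X \<phi> x"
    by (auto simp: Omega_limits_def)
  then have "y \<in> X closure_of ((\<lambda>s. \<phi> s x) ` {0..})"
    by (auto simp: omega_limit_def)
  then show "y \<in> topspace X"
    by (simp add: in_closure_of)
qed

lemma critical_points_subset_Omega_limits: "critical_points X \<phi> \<subseteq> Omega_limits X \<phi>"
proof
  fix x assume "x \<in> critical_points X \<phi>"
  then have x: "x \<in> topspace X" "\<And>t. \<phi> t x = x"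
    by (auto simp: critical_points_def)
  then have "x \<in> X closure_of ((\<lambda>s. \<phi> s x) ` {t..})" for t
    by (auto simp: in_closure_of)
  then show "x \<in> Omega_limits X \<phi>"
    using x(1) by (auto simp: Omega_limits_def omega_limit_def)
qed

lemma closedin_critical_points:
  assumes "flow X \<phi>" and "Hausdorff_space X"
  shows "closedin X (critical_points X \<phi>)"
proof -
  have "critical_points X \<phi> = (\<Inter>t. {x \<in> topspace X. \<phi> t x = x})"
    by (auto simp: critical_points_def)
  moreover have "closedin X {x \<in> topspace X. \<phi> t x = x}" for t
    using closedin_continuous_maps_eq[OF assms(2) continuous_map_flow_space[OF assms(1)] continuous_map_id]
    by (simp add: id_def)
  ultimately show ?thesis by auto
qed

section \<open>Complete flows\<close>

text \<open>An orbit inside the limit space is a path in every exterior set, so \<open>e\<^sub>0\<close> cannot tell its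
  points apart. In particular injectivity excludes nonconstant periodic orbits, which always lie in
  the limit space.\<close>

lemma ext_limit_eq_critical_points:
  assumes fl: "flow X \<phi>" and inj: "inj_on (e0 X (eps_r X \<phi>)) (ext_limit (eps_r X \<phi>))"
  shows "ext_limit (eps_r X \<phi>) = critical_points X \<phi>"
proof
  let ?L = "ext_limit (eps_r X \<phi>)"
  show "critical_points X \<phi> \<subseteq> ?L"
    by (rule critical_points_subset_ext_limit)
  show "?L \<subseteq> critical_points X \<phi>"
  proof
    fix x assume x: "x \<in> ?L"
    have X: "x \<in> topspace X"
      using x ext_limit_subset_topspace[OF externology_eps_r[OF fl]] by blast
    have inv: "\<phi> t x \<in> ?L" for t
      by (rule ext_limit_eps_r_invariant[OF fl x])
    have "\<phi> t x = x" for t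
    proof -
      have "path_component_of (subtopology X E) (\<phi> t x) x" if "E \<in> eps_r X \<phi>" for E
        using path_component_of_flow[OF fl X, of UNIV t 0 E] inv ext_limit_subset[OF that] fl X
        by (auto simp: flow_def)
      then have "e0 X (eps_r X \<phi>) (\<phi> t x) = e0 X (eps_r X \<phi>) x"
        unfolding e0_def by (intro restrict_ext path_component_of_set_eqI)
      then show ?thesis
        using inj inv x by (auto dest: inj_onD)
    qed
    then show "x \<in> critical_points X \<phi>"
      using X by (simp add: critical_points_def)
  qed
qed

text \<open>Every forward orbit has an end: beyond some time it stays in one path component of
  a given exterior set, and these components are compatible with inclusions.\<close>

lemma orbit_end_component:
  assumes fl: "flow X \<phi>" and x: "x \<in> topspace X"
  obtains a where "a \<in> topspace (check_pi0 X (eps_r X \<phi>))"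
    and "\<And>E. E \<in> eps_r X \<phi> \<Longrightarrow> \<exists>t0. \<forall>t>t0. \<phi> t x \<in> a E"
proof -
  let ?e = "eps_r X \<phi>"
  have "\<exists>C t0. \<forall>t>t0. \<phi> t x \<in> E \<and> path_component_of_set (subtopology X E) (\<phi> t x) = C"
    if "E \<in> ?e" for E
  proof -
    obtain t0 where t0: "\<And>t. t > t0 \<Longrightarrow> \<phi> t x \<in> E"
      using \<open>E \<in> ?e\<close> x unfolding eps_r_def by blast
    have "path_component_of (subtopology X E) (\<phi> t x) (\<phi> (t0 + 1) x)" if "t > t0" for t
      using that t0 by (intro path_component_of_flow[OF fl x, of "{t0<..}"]) (auto simp: is_interval_convex)
    then show ?thesis
      using t0 path_component_of_set_eqI by metis
  qed
  then obtain c where c: "\<And>E. E \<in> ?e \<Longrightarrow>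
      \<exists>t0. \<forall>t>t0. \<phi> t x \<in> E \<and> path_component_of_set (subtopology X E) (\<phi> t x) = c E"
    by metis
  define a where "a = restrict c ?e"
  have a: "\<exists>t0. \<forall>t>t0. \<phi> t x \<in> E \<and> a E = path_component_of_set (subtopology X E) (\<phi> t x)"
    if "E \<in> ?e" for E
    using c[OF that] that by (auto simp: a_def)
  have top: "\<phi> t x \<in> topspace X" for t
    by (rule flow_in_topspace[OF fl x])
  show thesis
  proof
    have "a E \<in> path_components_of (subtopology X E)" if E: "E \<in> ?e" for E
    proof -
      obtain t where "\<phi> t x \<in> E" "a E = path_component_of_set (subtopology X E) (\<phi> t x)"
        using a[OF E] gt_ex by metis
      then show ?thesis
        using top by (auto intro!: path_components_of_memI)
    qed
    moreover have "pi0_incl (subtopology X F) (a E) = a F"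
      if EF: "E \<in> ?e" "F \<in> ?e" "E \<subseteq> F" for E F
    proof -
      obtain r s where
        r: "\<forall>t>r. \<phi> t x \<in> E \<and> a E = path_component_of_set (subtopology X E) (\<phi> t x)" and
        s: "\<forall>t>s. \<phi> t x \<in> F \<and> a F = path_component_of_set (subtopology X F) (\<phi> t x)"
        using a EF(1,2) by meson
      obtain t where "t > r" "t > s"
        using gt_ex[of "max r s"] by auto
      then show ?thesis
        using r s pi0_incl_path_component[OF EF(3) top] by auto
    qed
    ultimately show "a \<in> topspace (check_pi0 X ?e)"
      by (auto simp: topspace_check_pi0 a_def)
    show "\<exists>t0. \<forall>t>t0. \<phi> t x \<in> a E" if "E \<in> ?e" for E
      using a[OF that] top by (metis Int_iff mem_Collect_eq path_component_of_refl topspace_subtopology)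
  qed
qed

text \<open>If the end of an orbit is \<open>e\<^sub>0(c)\<close>, the orbit eventually enters each of the small path
  components around \<open>c\<close>, so it converges to \<open>c\<close> and has no other limit point.\<close>

lemma Omega_limits_subset_ext_limit:
  assumes fl: "flow X \<phi>" and haus: "Hausdorff_space X"
    and surj: "topspace (check_pi0 X (eps_r X \<phi>)) \<subseteq>
      e0 X (eps_r X \<phi>) ` ext_limit (eps_r X \<phi>)"
    and small: "small_path_components X (eps_r X \<phi>)"
  shows "Omega_limits X \<phi> \<subseteq> ext_limit (eps_r X \<phi>)"
proof
  let ?e = "eps_r X \<phi>"
  fix y assume "y \<in> Omega_limits X \<phi>"
  then obtain x where x: "x \<in> topspace X" and y: "y \<in> omega_limit X \<phi> x"
    by (auto simp: Omega_limits_def)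
  obtain a where a: "a \<in> topspace (check_pi0 X ?e)"
    and aE: "\<And>E. E \<in> ?e \<Longrightarrow> \<exists>t0. \<forall>t>t0. \<phi> t x \<in> a E"
    using orbit_end_component[OF fl x] by blast
  obtain c where c: "c \<in> ext_limit ?e" "a = e0 X ?e c"
    using surj a by blast
  have "y = c"
  proof (rule ccontr)
    assume "y \<noteq> c"
    moreover have ytop: "y \<in> topspace X"
      using y closure_of_subset_topspace[of X] by (force simp: omega_limit_def)
    moreover have "c \<in> topspace X"
      using c ext_limit_subset_topspace[OF externology_eps_r[OF fl]] by blast
    ultimately obtain U V where UV: "openin X U" "openin X V" "y \<in> U" "c \<in> V" "disjnt U V"
      using haus unfolding Hausdorff_space_def by metis
    then obtain E where E: "E \<in> ?e" "path_component_of_set (subtopology X E) c \<subseteq> V"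
      using small c(1) unfolding small_path_components_def by blast
    obtain t0 where t0: "\<And>t. t > t0 \<Longrightarrow> \<phi> t x \<in> V"
      using aE[OF E(1)] E c(2) by (auto simp: e0_def)
    have "y \<in> X closure_of ((\<lambda>s. \<phi> s x) ` {max 0 (t0 + 1)..})"
      using y by (auto simp: omega_limit_def)
    then obtain z where "z \<in> (\<lambda>s. \<phi> s x) ` {max 0 (t0 + 1)..}" "z \<in> U"
      using UV(1,3) unfolding in_closure_of by blast
    then obtain s where "s \<ge> t0 + 1" "\<phi> s x \<in> U"
      by auto
    then show False
      using t0[of s] UV(5) by (auto simp: disjnt_iff)
  qed
  then show "y \<in> ext_limit ?e" using c(1) by simp
qed

text \<open>A connected subset of \<open>L\<close> lies in a single connected component of each exterior set \<open>E\<close>; local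
  path-connectedness identifies it with a path component of \<open>E\<close>, and these can be chosen to miss
  any other given point.\<close>

lemma totally_disconnected_ext_limit:
  assumes ext: "externology X \<epsilon>" and lpc: "locally_path_connected_space X" and t1: "t1_space X"
    and small: "small_path_components X \<epsilon>"
  shows "totally_disconnected_space (subtopology X (ext_limit \<epsilon>))"
  unfolding totally_disconnected_space_def
proof (intro ballI)
  let ?Y = "subtopology X (ext_limit \<epsilon>)"
  fix x assume xY: "x \<in> topspace ?Y"
  then have x: "x \<in> ext_limit \<epsilon>" "x \<in> topspace X" by auto
  have "y = x" if y: "connected_component_of ?Y x y" for y
  proof (rule ccontr)
    assume "y \<noteq> x"
    obtain T where T: "connectedin ?Y T" "x \<in> T" "y \<in> T"
      using y by (auto simp: connected_component_of_def)
    have "openin X (topspace X - {y})"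
      using t1 T connectedin_subset_topspace[OF T(1)] by (auto simp: t1_space_openin_delete_alt)
    then obtain E where E: "E \<in> \<epsilon>" "path_component_of_set (subtopology X E) x \<subseteq> topspace X - {y}"
      using small x \<open>y \<noteq> x\<close> unfolding small_path_components_def by blast
    have "connectedin (subtopology X E) T"
      using T(1) ext_limit_subset[OF E(1)] by (auto simp: connectedin_subtopology)
    then have "connected_component_of (subtopology X E) x y"
      using T by (auto simp: connected_component_of_def)
    moreover have "locally_path_connected_space (subtopology X E)"
      using locally_path_connected_space_open_subset[OF lpc externology_openin[OF ext E(1)]] .
    ultimately have "path_component_of (subtopology X E) x y"
      using path_component_eq_connected_component_of by (metis mem_Collect_eq)
    then show False using E(2) by blast
  qed
  then show "connected_component_of_set ?Y x = {x}"
    using xY by (auto simp: connected_component_of_refl)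
qed

section \<open>Limit points forming a Stone space of critical points\<close>

text \<open>If an orbit left \<open>N\<close> at arbitrarily large times, then the closures of its tails, with \<open>N\<close>
  removed, would be a decreasing sequence of nonempty closed sets; compactness would give a limit
  point outside \<open>N\<close>.\<close>

lemma eps_r_if_Omega_limits_subset:
  assumes flow: "flow X \<phi>" and comp: "compact_space X" and N: "openin X N" and sub: "Omega_limits X \<phi> \<subseteq> N"
  shows "N \<in> eps_r X \<phi>"
proof -
  have "\<exists>t0. \<forall>t>t0. \<phi> t x \<in> N" if x: "x \<in> topspace X" for x
  proof (rule ccontr)
    assume neg: "\<nexists>t0. \<forall>t>t0. \<phi> t x \<in> N"
    define D where "D n = X closure_of ((\<lambda>s. \<phi> s x) ` {real n..}) - N" for n
    have cl: "closedin X (D n)" for n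
      unfolding D_def using N by (intro closedin_diff) auto
    have ne: "D n \<noteq> {}" for n
    proof -
      obtain t where "t > real n" "\<phi> t x \<notin> N" using neg by blast
      moreover have "\<phi> t x \<in> X closure_of ((\<lambda>s. \<phi> s x) ` {real n..})"
        using flow_in_topspace[OF flow x] \<open>t > real n\<close>
          closure_of_subset[of "(\<lambda>s. \<phi> s x) ` {real n..}" X]
        by (meson atLeast_iff image_eqI image_subsetI less_imp_le subsetD)
      ultimately show ?thesis by (auto simp: D_def)
    qed
    have dec: "decseq D"
      unfolding decseq_def D_def by (intro allI impI Diff_mono closure_of_mono image_mono) auto
    obtain z where z: "\<And>n. z \<in> D n"
      using compact_space_imp_nest[OF comp cl ne dec] by blast
    have "z \<in> X closure_of ((\<lambda>s. \<phi> s x) ` {t..})" for t :: real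
    proof -
      obtain n where "t \<le> real n" using real_arch_simple by blast
      then have "X closure_of ((\<lambda>s. \<phi> s x) ` {real n..}) \<subseteq> X closure_of ((\<lambda>s. \<phi> s x) ` {t..})"
        by (intro closure_of_mono image_mono) auto
      then show ?thesis using z[of n] by (auto simp: D_def)
    qed
    then have "z \<in> Omega_limits X \<phi>"
      using x by (auto simp: Omega_limits_def omega_limit_def)
    then show False
      using sub z[of 0] by (auto simp: D_def)
  qed
  then show ?thesis
    using N by (simp add: eps_r_def)
qed

text \<open>Removing a point outside \<open>S\<close> from \<open>X\<close> leaves an open set that contains all limit points and is
  therefore exterior.\<close>

lemma ext_limit_eps_r_subset:
  assumes "flow X \<phi>" and "compact_space X" and "t1_space X" and "closedin X S"
    and sub: "Omega_limits X \<phi> \<subseteq> S"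
  shows "ext_limit (eps_r X \<phi>) \<subseteq> S"
proof
  fix y assume y: "y \<in> ext_limit (eps_r X \<phi>)"
  show "y \<in> S"
  proof (rule ccontr)
    assume "y \<notin> S"
    have "openin X (topspace X - {y})"
      using assms(3) y ext_limit_subset_topspace[OF externology_eps_r[OF assms(1)]]
      by (auto simp: t1_space_openin_delete_alt)
    moreover have "Omega_limits X \<phi> \<subseteq> topspace X - {y}"
      using sub closedin_subset[OF assms(4)] \<open>y \<notin> S\<close> by blast
    ultimately have "topspace X - {y} \<in> eps_r X \<phi>"
      by (rule eps_r_if_Omega_limits_subset[OF assms(1,2)])
    then show False
      using y by (auto simp: ext_limit_def)
  qed
qed

text \<open>In the Stone space \<open>L\<close> a point \<open>x\<close> has a clopen neighbourhood \<open>K \<subseteq> U\<close>. Both \<open>K\<close> and its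
  complement in \<open>L\<close> are compact, hence separated by disjoint open sets of \<open>X\<close>; their union is an
  exterior set in which \<open>x\<close> cannot be joined to a point outside \<open>U\<close>.\<close>

lemma small_path_components_Stone:
  assumes haus: "Hausdorff_space X" and L: "ext_limit \<epsilon> \<subseteq> topspace X"
    and nbhds: "\<And>N. openin X N \<Longrightarrow> ext_limit \<epsilon> \<subseteq> N \<Longrightarrow> N \<in> \<epsilon>"
    and stone: "Stone_space (subtopology X (ext_limit \<epsilon>))"
  shows "small_path_components X \<epsilon>"
  unfolding small_path_components_def
proof (intro ballI allI impI)
  fix x U assume x: "x \<in> ext_limit \<epsilon>" and U: "openin X U \<and> x \<in> U"
  define Y where "Y = subtopology X (ext_limit \<epsilon>)"
  have Y: "Hausdorff_space Y" "compact_space Y" "totally_disconnected_space Y"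
    and topY: "topspace Y = ext_limit \<epsilon>"
    using stone L by (auto simp: Stone_space_def Y_def)
  have xY: "x \<in> topspace Y"
    using x topY by simp
  have "{x} \<in> connected_components_of Y"
    using Y(3) xY connected_component_in_connected_components_of[of Y x]
    by (simp add: totally_disconnected_space_def)
  moreover have "closedin Y (ext_limit \<epsilon> - U)"
  proof -
    have "ext_limit \<epsilon> - U = (topspace X - U) \<inter> ext_limit \<epsilon>"
      using L by blast
    then show ?thesis
      using U unfolding Y_def closedin_subtopology by blast
  qed
  ultimately have "separated_between Y {x} (ext_limit \<epsilon> - U)"
    using Y(1,2) U xY
    by (intro separated_between_compact_connected_component compact_imp_locally_compact_space) auto
  then obtain K K' where K: "openin Y K" "openin Y K'" "K \<union> K' = topspace Y" "disjnt K K'"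
    "x \<in> K" "ext_limit \<epsilon> - U \<subseteq> K'"
    unfolding separated_between_def by blast
  have "K = topspace Y - K'" "K' = topspace Y - K"
    using K by (auto simp: disjnt_iff)
  then have "closedin Y K" "closedin Y K'"
    using K(1,2) by (metis closedin_diff closedin_topspace)+
  then have "compactin X K" "compactin X K'"
    using closedin_compact_space[OF Y(2)] by (auto simp: Y_def compactin_subtopology)
  then obtain V V' where V: "openin X V" "openin X V'" "K \<subseteq> V" "K' \<subseteq> V'" "disjnt V V'"
    using Hausdorff_space_compact_separation[OF haus] K(4) by metis
  define E where "E = V \<inter> U \<union> V'"
  have "openin X E"
    using V U by (auto simp: E_def)
  moreover have "ext_limit \<epsilon> \<subseteq> E"
    using K V topY by (fastforce simp: E_def disjnt_iff)
  ultimately have "E \<in> \<epsilon>"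
    by (rule nbhds)
  moreover have "y \<in> U" if y: "path_component_of (subtopology X E) x y" for y
  proof -
    obtain T where T: "path_connectedin (subtopology X E) T" "x \<in> T" "y \<in> T"
      using y by (auto simp: path_component_of)
    then have "connectedin X T" "T \<subseteq> E"
      using path_connectedin_imp_connectedin by (auto simp: path_connectedin_subtopology)
    then have "\<not> (T \<subseteq> (V \<inter> U) \<union> V' \<and> (V \<inter> U) \<inter> V' \<inter> T = {} \<and> (V \<inter> U) \<inter> T \<noteq> {} \<and> V' \<inter> T \<noteq> {})"
      using V(1,2) U openin_Int[of X V U] unfolding connectedin by meson
    then show ?thesis
      using \<open>T \<subseteq> E\<close> T V K U by (auto simp: E_def disjnt_iff)
  qed
  ultimately show "\<exists>E \<in> \<epsilon>. path_component_of_set (subtopology X E) x \<subseteq> U"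
    by blast
qed

lemma inj_on_e0_small:
  assumes t1: "t1_space X" and L: "ext_limit \<epsilon> \<subseteq> topspace X" and small: "small_path_components X \<epsilon>"
  shows "inj_on (e0 X \<epsilon>) (ext_limit \<epsilon>)"
proof (rule inj_onI, rule ccontr)
  fix x y assume x: "x \<in> ext_limit \<epsilon>" and y: "y \<in> ext_limit \<epsilon>"
    and eq: "e0 X \<epsilon> x = e0 X \<epsilon> y" and "x \<noteq> y"
  have "openin X (topspace X - {y})"
    using t1 y L by (auto simp: t1_space_openin_delete_alt)
  then obtain E where E: "E \<in> \<epsilon>" "path_component_of_set (subtopology X E) x \<subseteq> topspace X - {y}"
    using small x L \<open>x \<noteq> y\<close> unfolding small_path_components_def by blast
  have "path_component_of_set (subtopology X E) x = path_component_of_set (subtopology X E) y"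
    using fun_cong[OF eq, of E] E(1) by (simp add: e0_def)
  moreover have "y \<in> path_component_of_set (subtopology X E) y"
    using y L ext_limit_subset[OF E(1)] by (auto simp: path_component_of_refl)
  ultimately show False
    using E(2) by blast
qed

lemma check_pi0_subset:
  assumes a: "a \<in> topspace (check_pi0 X \<epsilon>)" and DE: "D \<in> \<epsilon>" "E \<in> \<epsilon>" "D \<subseteq> E"
  shows "a D \<subseteq> a E"
proof
  fix y assume y: "y \<in> a D"
  then have "y \<in> topspace (subtopology X E)"
    using path_components_of_subset[OF check_pi0_mem[OF a DE(1)]] DE(3) by auto
  then have "y \<in> pi0_incl (subtopology X E) (a D)"
    using y path_component_of_refl[of "subtopology X E" y] by (auto simp: pi0_incl_def)
  then show "y \<in> a E"
    using check_pi0_compat[OF a DE] by simp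
qed

text \<open>Let \<open>a\<close> be a point of the inverse limit. Each \<open>a E\<close> is relatively clopen in \<open>E\<close>. If it missed
  \<open>L\<close>, then \<open>E - a E\<close> would be exterior, and compatibility would put \<open>a (E - a E)\<close> inside \<open>a E\<close>,
  which is absurd. So the sets \<open>a E \<inter> L\<close> are nonempty, closed in \<open>L\<close> and directed downwards, and
  compactness gives a point common to all of them, which \<open>e\<^sub>0\<close> sends to \<open>a\<close>.\<close>

lemma e0_surj_compact:
  assumes ext: "externology X \<epsilon>" and lpc: "locally_path_connected_space X"
    and comp: "compact_space (subtopology X (ext_limit \<epsilon>))"
    and nbhds: "\<And>N. openin X N \<Longrightarrow> ext_limit \<epsilon> \<subseteq> N \<Longrightarrow> N \<in> \<epsilon>"
  shows "topspace (check_pi0 X \<epsilon>) \<subseteq> e0 X \<epsilon> ` ext_limit \<epsilon>"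
proof
  fix a assume a: "a \<in> topspace (check_pi0 X \<epsilon>)"
  let ?L = "ext_limit \<epsilon>"
  let ?Y = "subtopology X ?L"
  obtain E0 where E0: "E0 \<in> \<epsilon>"
    using ext by (auto simp: externology_def)
  have lpcE: "locally_path_connected_space (subtopology X E)" if "E \<in> \<epsilon>" for E
    using locally_path_connected_space_open_subset[OF lpc externology_openin[OF ext that]] .
  have clE: "closedin (subtopology X E) (a E)" if "E \<in> \<epsilon>" for E
    using closedin_path_components_of_locally_path_connected_space[OF lpcE[OF that]]
      check_pi0_mem[OF a that] by blast
  have cl: "closedin ?Y (a E \<inter> ?L)" if E: "E \<in> \<epsilon>" for E
  proof -
    obtain S where "closedin X S" "a E = S \<inter> E"
      using clE[OF E] by (auto simp: closedin_subtopology)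
    then show ?thesis
      using ext_limit_subset[OF E] by (auto simp: closedin_subtopology)
  qed
  have ne: "a E \<inter> ?L \<noteq> {}" if E: "E \<in> \<epsilon>" for E
  proof
    assume empty: "a E \<inter> ?L = {}"
    have "openin (subtopology X E) (topspace (subtopology X E) - a E)"
      using clE[OF E] by blast
    then have "openin X (E - a E)"
      using openin_subset[OF externology_openin[OF ext E]] externology_openin[OF ext E]
      by (metis Int_absorb1 openin_trans_full topspace_subtopology)
    then have D: "E - a E \<in> \<epsilon>"
      using empty ext_limit_subset[OF E] by (intro nbhds) auto
    have "a (E - a E) \<subseteq> a E"
      using check_pi0_subset[OF a D E] by blast
    moreover have "a (E - a E) \<subseteq> E - a E" "a (E - a E) \<noteq> {}"
      using path_components_of_subset[OF check_pi0_mem[OF a D]]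
        nonempty_path_components_of[OF check_pi0_mem[OF a D]] by auto
    ultimately show False by blast
  qed
  have dir: "\<exists>D \<in> \<epsilon>. \<forall>E \<in> \<F>. a D \<subseteq> a E" if "finite \<F>" "\<F> \<subseteq> \<epsilon>" for \<F>
    using that
  proof (induction \<F>)
    case empty
    then show ?case using E0 by blast
  next
    case (insert F \<F>)
    then obtain D where D: "D \<in> \<epsilon>" "\<forall>E \<in> \<F>. a D \<subseteq> a E" by auto
    have "D \<inter> F \<in> \<epsilon>"
      using externology_Int[OF ext D(1)] insert.prems by blast
    then have "a (D \<inter> F) \<subseteq> a D" "a (D \<inter> F) \<subseteq> a F"
      using check_pi0_subset[OF a] D(1) insert.prems by (simp_all add: Int_lower1 Int_lower2)
    then show ?case
      using \<open>D \<inter> F \<in> \<epsilon>\<close> D(2) by (intro bexI[of _ "D \<inter> F"]) auto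
  qed
  have "\<Inter>((\<lambda>E. a E \<inter> ?L) ` \<epsilon>) \<noteq> {}"
  proof -
    have fip: "\<Inter>\<G> \<noteq> {}" if fin: "finite \<G>" and sub: "\<G> \<subseteq> (\<lambda>E. a E \<inter> ?L) ` \<epsilon>" for \<G>
    proof -
      obtain \<F> where F: "\<F> \<subseteq> \<epsilon>" "finite \<F>" "\<G> = (\<lambda>E. a E \<inter> ?L) ` \<F>"
        using finite_subset_image[OF fin sub] by blast
      then obtain D where "D \<in> \<epsilon>" "\<forall>E \<in> \<F>. a D \<subseteq> a E"
        using dir by blast
      then show ?thesis
        using ne[of D] F(3) by blast
    qed
    have "\<forall>C \<in> (\<lambda>E. a E \<inter> ?L) ` \<epsilon>. closedin ?Y C"
      using cl by blast
    then show ?thesis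
      using fip by (intro compact_space_fip[THEN iffD1, OF comp, THEN spec, THEN mp]) auto
  qed
  then obtain c where c: "\<And>E. E \<in> \<epsilon> \<Longrightarrow> c \<in> a E" "c \<in> ?L"
    using E0 by blast
  have "e0 X \<epsilon> c = a"
  proof
    fix E
    show "e0 X \<epsilon> c E = a E"
    proof (cases "E \<in> \<epsilon>")
      case True
      obtain y where "a E = path_component_of_set (subtopology X E) y"
        using check_pi0_mem[OF a True] by (auto simp: path_components_of_def)
      then show ?thesis
        using c(1)[OF True] path_component_of_set_eqI True by (fastforce simp: e0_def)
    next
      case False
      then show ?thesis
        using a by (auto simp: topspace_check_pi0 e0_def PiE_def extensional_def)
    qed
  qed
  then show "a \<in> e0 X \<epsilon> ` ?L"
    using c(2) by blast
qed

section \<open>The characterisation of complete flows\<close>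

theorem theorem6p6:
  fixes X :: "'a topology" and \<phi> :: "real \<Rightarrow> 'a \<Rightarrow> 'a"
  assumes "flow X \<phi>"
    and "metrizable_space X"
    and "compact_space X"
    and "locally_path_connected_space X"
  shows "check_C0_r_complete X \<phi> \<longleftrightarrow>
           critical_points X \<phi> = X closure_of (Omega_limits X \<phi>) \<and>
           Stone_space (subtopology X (critical_points X \<phi>))"
proof -
  let ?e = "eps_r X \<phi>"
  let ?L = "ext_limit ?e"
  let ?C = "critical_points X \<phi>"
  have ext: "externology X ?e"
    by (rule externology_eps_r[OF assms(1)])
  have haus: "Hausdorff_space X"
    by (rule metrizable_imp_Hausdorff_space[OF assms(2)])
  have t1: "t1_space X"
    by (rule Hausdorff_imp_t1_space[OF haus])
  have Lsub: "?L \<subseteq> topspace X"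
    by (rule ext_limit_subset_topspace[OF ext])
  have clC: "closedin X ?C"
    by (rule closedin_critical_points[OF assms(1) haus])
  show ?thesis
    unfolding check_C0_r_complete_def
  proof (intro iffI conjI)
    assume hom: "homeomorphic_map X (check_C0 X ?e) (p0 X ?e)"
    note bij = homeomorphic_p0_imp(1)[OF ext hom] and small = homeomorphic_p0_imp(2)[OF ext hom]
    have LC: "?L = ?C"
      using bij by (intro ext_limit_eq_critical_points assms(1)) (simp add: bij_betw_def)
    have "Omega_limits X \<phi> \<subseteq> ?C"
      using Omega_limits_subset_ext_limit[OF assms(1) haus _ small] bij LC by (simp add: bij_betw_def)
    then have "Omega_limits X \<phi> = ?C"
      by (rule subset_antisym[OF _ critical_points_subset_Omega_limits])
    then show "?C = X closure_of Omega_limits X \<phi>"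
      using closure_of_closedin[OF clC] by simp
    show "Stone_space (subtopology X ?C)"
      using totally_disconnected_ext_limit[OF ext assms(4) t1 small] LC
        Hausdorff_space_subtopology[OF haus] closedin_compact_space[OF assms(3) clC]
      by (simp add: Stone_space_def compact_space_subtopology)
  next
    assume asm: "?C = X closure_of Omega_limits X \<phi> \<and> Stone_space (subtopology X ?C)"
    have "Omega_limits X \<phi> \<subseteq> topspace X"
      by (rule Omega_limits_subset_topspace)
    then have Om: "Omega_limits X \<phi> \<subseteq> ?C"
      using asm closure_of_subset by metis
    then have LC: "?L = ?C"
      by (intro subset_antisym critical_points_subset_ext_limit
          ext_limit_eps_r_subset[OF assms(1,3) t1 clC])
    have nbhds: "N \<in> ?e" if "openin X N" "?L \<subseteq> N" for N
      using eps_r_if_Omega_limits_subset[OF assms(1,3) that(1)] that(2) Om LC by blast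
    have stone: "Stone_space (subtopology X ?L)"
      using asm unfolding LC by (rule conjunct2)
    have small: "small_path_components X ?e"
      by (rule small_path_components_Stone[OF haus Lsub nbhds stone])
    have "topspace (check_pi0 X ?e) \<subseteq> e0 X ?e ` ?L"
      using stone by (intro e0_surj_compact[OF ext assms(4)] nbhds) (auto simp: Stone_space_def)
    then have "bij_betw (e0 X ?e) ?L (topspace (check_pi0 X ?e))"
      using inj_on_e0_small[OF t1 Lsub small] e0_in_check_pi0[OF ext] by (auto simp: bij_betw_def)
    then show "homeomorphic_map X (check_C0 X ?e) (p0 X ?e)"
      by (rule homeomorphic_p0I[OF ext assms(4) _ small])
  qed
qed

end
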